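(* The crossing number of the generalized Petersen graph $P(10,3)$ equals $6$, i.e. $cr(P(10,3))=6$.
   Context: For $n\ge 3$ and $k\in\mathbb{Z}_n\setminus\{0\}$, the generalized Petersen graph $P(n,k)$ has vertex set $\{x_i,y_i : i\in\mathbb{Z}_n\}$ and edges $x_ix_{i+1}$, $x_iy_i$, $y_iy_{i+k}$ (indices mod $n$). The crossing number $cr(G)$ of a graph $G$ is the minimum, over all drawings of $G$ in the plane, of the number of pairwise crossings of edges. *)

theory Defs
  imports "HOL-Analysis.Analysis"
begin

text \<open>The residues modulo n are represented by the natural numbers below n. The intended range of
  the parameters is \<^term>\<open>3 \<le> (n::nat)\<close> and \<^term>\<open>0 < k \<and> k < (n::nat)\<close>.\<close>

datatype gp_vertex = X nat | Y nat

definition gp_vertices :: "nat \<Rightarrow> gp_vertex set" where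
  "gp_vertices n = X ` {..<n} \<union> Y ` {..<n}"

definition gp_edges :: "nat \<Rightarrow> nat \<Rightarrow> gp_vertex set set" where
  "gp_edges n k =
     {{X i, X ((i + 1) mod n)} | i. i < n} \<union>
     {{X i, Y i} | i. i < n} \<union>
     {{Y i, Y ((i + k) mod n)} | i. i < n}"

definition curve_interior :: "(real \<Rightarrow> complex) \<Rightarrow> complex set" where
  "curve_interior g = path_image g - {pathstart g, pathfinish g}"

text \<open>Two point sets cross at p if, up to a homeomorphism of a neighbourhood of p onto the open
  unit disc, they look like the two coordinate axes. This excludes tangential contact.\<close>

definition crosses_at :: "complex set \<Rightarrow> complex set \<Rightarrow> complex \<Rightarrow> bool" where
  "crosses_at A B p \<longleftrightarrow>
     (\<exists>U h h'. open U \<and> p \<in> U \<and> homeomorphism U (ball 0 1) h h' \<and> h p = 0 \<and>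
        h ` (A \<inter> U) = {z \<in> ball 0 1. Im z = 0} \<and>
        h ` (B \<inter> U) = {z \<in> ball 0 1. Re z = 0})"

text \<open>A crossing is a pair of distinct edges together with a common point of their interiors, so
  two edges meeting in several points contribute once for every such point.\<close>

definition crossings ::
    "'a set set \<Rightarrow> ('a set \<Rightarrow> real \<Rightarrow> complex) \<Rightarrow> ('a set set \<times> complex) set" where
  "crossings E \<gamma> =
     {({e, f}, p) | e f p. e \<in> E \<and> f \<in> E \<and> e \<noteq> f \<and>
        p \<in> curve_interior (\<gamma> e) \<inter> curve_interior (\<gamma> f)}"

text \<open>A drawing of the simple graph with vertex set V and edge set E (a set of two-element subsets
  of V) in the plane: vertices go to distinct points, edges to simple arcs joining the images of
  their ends and meeting no other vertex, there are finitely many crossings, all of them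
  transversal, and no three edges cross at one point. Edges with a common end may cross, and two
  edges may cross more than once.\<close>

definition is_drawing ::
    "'a set \<Rightarrow> 'a set set \<Rightarrow> ('a \<Rightarrow> complex) \<Rightarrow> ('a set \<Rightarrow> real \<Rightarrow> complex) \<Rightarrow> bool" where
  "is_drawing V E pos \<gamma> \<longleftrightarrow>
     inj_on pos V \<and>
     (\<forall>e\<in>E. arc (\<gamma> e) \<and> {pathstart (\<gamma> e), pathfinish (\<gamma> e)} = pos ` e \<and>
        path_image (\<gamma> e) \<inter> pos ` V = pos ` e) \<and>
     finite (crossings E \<gamma>) \<and>
     (\<forall>e\<in>E. \<forall>f\<in>E. e \<noteq> f \<longrightarrow>
        (\<forall>p \<in> curve_interior (\<gamma> e) \<inter> curve_interior (\<gamma> f).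
           crosses_at (path_image (\<gamma> e)) (path_image (\<gamma> f)) p)) \<and>
     (\<forall>e\<in>E. \<forall>f\<in>E. \<forall>g\<in>E. e \<noteq> f \<and> e \<noteq> g \<and> f \<noteq> g \<longrightarrow>
        curve_interior (\<gamma> e) \<inter> curve_interior (\<gamma> f) \<inter> curve_interior (\<gamma> g) = {})"

definition crossing_number :: "'a set \<Rightarrow> 'a set set \<Rightarrow> nat" where
  "crossing_number V E = (LEAST c. \<exists>pos \<gamma>. is_drawing V E pos \<gamma> \<and> card (crossings E \<gamma>) = c)"

end

theory Submission
  imports Defs "HOL-Library.Code_Binary_Nat"
begin

text \<open>Lower bound. For disjoint arcs \<open>g\<close> and \<open>h\<close> the difference \<open>g s - h t\<close> has a continuous
  logarithm on the unit square, so its increments along the boundary sum to zero. Modulo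
  \<open>2 * pi * \<i>\<close> these increments are determined by the ends of the arcs. Hence disjoint edges satisfy a
  parity condition with one unknown integer for each pair of a vertex and an edge (this is the van
  Kampen obstruction modulo 2). If in the sum of the conditions over a set of pairs of independent
  edges all unknowns cancel while the known part is odd, then some pair in the set crosses. There are
  five such sets which, with suitable weights and together with their rotations, have total weight
  200, whereas no pair of edges lies in sets of total weight more than 36. So more than 5 pairs cross.

  Upper bound. A straight-line drawing on an integer grid has six crossings.\<close>

section \<open>A parity condition for disjoint arcs\<close>

text \<open>The exponential of \<open>M - L\<close> is the constant \<open>k\<close>, so
  \<open>M - L\<close> takes values in one coset of the discrete group generated by 2 * pi * i;
  being continuous on an interval, it is constant.\<close>

lemma exp_lifts_increment:
  fixes L M :: "real \<Rightarrow> complex"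
  assumes "continuous_on {0..1} L" "continuous_on {0..1} M"
    and k: "\<And>t. t \<in> {0..1} \<Longrightarrow> exp (M t) = k * exp (L t)"
  shows "M 1 - M 0 = L 1 - L 0"
proof -
  have "(\<lambda>t. M t - L t) constant_on {0..1}"
  proof (rule continuous_discrete_range_constant)
    show "continuous_on {0..1} (\<lambda>t. M t - L t)"
      using assms by (intro continuous_intros)
    fix s :: real assume s: "s \<in> {0..1}"
    have "2 * pi \<le> norm ((M t - L t) - (M s - L s))"
      if t: "t \<in> {0..1}" "M t - L t \<noteq> M s - L s" for t
    proof -
      have "exp (M t - L t) = exp (M s - L s)"
        using k[OF s] k[OF t(1)] by (simp add: exp_diff)
      then obtain m :: int where m: "M t - L t = M s - L s + of_int (2 * m) * pi * \<i>"
        unfolding exp_eq by blast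
      with t have "m \<noteq> 0" by auto
      then have "1 \<le> \<bar>real_of_int m\<bar>" by linarith
      with m show ?thesis by (simp add: norm_mult)
    qed
    then show "\<exists>e>0. \<forall>t. t \<in> {0..1} \<and> M t - L t \<noteq> M s - L s \<longrightarrow>
        e \<le> norm ((M t - L t) - (M s - L s))"
      by (intro exI[of _ "2 * pi"]) auto
  qed simp
  then obtain c where "\<And>t. t \<in> {0..1} \<Longrightarrow> M t - L t = c"
    unfolding constant_on_def by blast
  from this[of 0] this[of 1] show ?thesis by (simp add: algebra_simps)
qed

text \<open>The total change of log (g - c) along a path \<open>g\<close>. The choice is harmless
  when \<open>c\<close> is off the path, since any two lifts have the same increment.\<close>

definition log_change :: "(real \<Rightarrow> complex) \<Rightarrow> complex \<Rightarrow> complex" where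
  "log_change g c = (SOME d. \<exists>L. continuous_on {0..1} L \<and>
     (\<forall>t\<in>{0..1}. exp (L t) = g t - c) \<and> d = L 1 - L 0)"

text \<open>The factor \<open>k\<close> admits lifts of multiples of \<open>g t - c\<close>. With
  \<open>k = -1\<close> a single logarithm of \<open>g s - h t\<close> serves for \<open>h\<close>
  about points of \<open>g\<close> as well as for \<open>g\<close> about points of
  \<open>h\<close>.\<close>

lemma log_change_eq:
  assumes L: "continuous_on {0..1} L" and k: "k \<noteq> 0"
    and eq: "\<And>t. t \<in> {0..1} \<Longrightarrow> exp (L t) = k * (g t - c)"
  shows "log_change g c = L 1 - L 0"
proof -
  have "\<exists>d M. continuous_on {0..1} M \<and> (\<forall>t\<in>{0..1}. exp (M t) = g t - c) \<and> d = M 1 - M 0"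
    using L k eq
    by (intro exI[of _ "L 1 - L 0"] exI[of _ "\<lambda>t. L t - Ln k"])
      (auto intro!: continuous_intros simp: exp_diff)
  from someI_ex[OF this] obtain M where M: "continuous_on {0..1} M"
      "\<forall>t\<in>{0..1}. exp (M t) = g t - c" "log_change g c = M 1 - M 0"
    unfolding log_change_def by blast
  show ?thesis
    using exp_lifts_increment[of M L k] M L eq by simp
qed

lemma exp_log_change:
  assumes "path g" "c \<notin> path_image g"
  shows "exp (log_change g c) = (pathfinish g - c) / (pathstart g - c)"
proof -
  obtain L where L: "continuous_on {0..1} L" "\<And>t. t \<in> {0..1} \<Longrightarrow> g t - c = exp (L t)"
  proof (rule continuous_logarithm_on_contractible[of "{0..1}" "\<lambda>t. g t - c"])
    show "continuous_on {0..1} (\<lambda>t. g t - c)"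
      using assms by (auto simp: path_def intro!: continuous_intros)
    show "\<And>t. t \<in> {0..1} \<Longrightarrow> g t - c \<noteq> 0"
      using assms by (auto simp: path_image_def)
  qed (auto intro: convex_imp_contractible)
  have "log_change g c = L 1 - L 0"
    using L by (intro log_change_eq[of L 1]) auto
  then show ?thesis
    using L(2)[of 0] L(2)[of 1] by (simp add: exp_diff pathstart_def pathfinish_def)
qed

text \<open>With \<open>H\<close> a logarithm of \<open>g s - h t\<close> on the square, both sides
  equal \<open>H (1, 1) - H (0, 0)\<close>, read off along the two ways round the boundary.\<close>

lemma log_change_disjoint:
  assumes g: "path g" and h: "path h" and disj: "path_image g \<inter> path_image h = {}"
  shows "log_change g (pathstart h) + log_change h (pathfinish g) =
         log_change h (pathstart g) + log_change g (pathfinish h)"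
proof -
  obtain H where H: "continuous_on ({0..1} \<times> {0..1}) H"
    "\<And>z. z \<in> {0..1} \<times> {0..1} \<Longrightarrow> g (fst z) - h (snd z) = exp (H z)"
  proof (rule continuous_logarithm_on_contractible[of "{0..1} \<times> {0..1}" "\<lambda>z. g (fst z) - h (snd z)"])
    have "continuous_on ({0..1} \<times> {0..1}) (\<lambda>z :: real \<times> real. g (fst z))"
      using g unfolding path_def
      by (rule continuous_on_compose2) (auto intro: continuous_on_fst continuous_on_id)
    moreover have "continuous_on ({0..1} \<times> {0..1}) (\<lambda>z :: real \<times> real. h (snd z))"
      using h unfolding path_def
      by (rule continuous_on_compose2) (auto intro: continuous_on_snd continuous_on_id)
    ultimately show "continuous_on ({0..1} \<times> {0..1}) (\<lambda>z. g (fst z) - h (snd z))"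
      by (rule continuous_on_diff)
    show "contractible ({0..1::real} \<times> {0..1::real})"
      by (intro convex_imp_contractible convex_Times) auto
    fix z :: "real \<times> real" assume "z \<in> {0..1} \<times> {0..1}"
    then have "g (fst z) \<in> path_image g" "h (snd z) \<in> path_image h"
      unfolding path_image_def by auto
    then show "g (fst z) - h (snd z) \<noteq> 0"
      using disj by auto
  qed (rule that)
  have vert: "log_change h (g s) = H (s, 1) - H (s, 0)" if s: "s \<in> {0..1}" for s
  proof (rule log_change_eq[of "\<lambda>t. H (s, t)" "-1"])
    show "continuous_on {0..1} (\<lambda>t. H (s, t))"
      using s by (intro continuous_on_compose2[OF H(1)] continuous_intros) auto
    show "exp (H (s, t)) = - 1 * (h t - g s)" if "t \<in> {0..1}" for t
      using H(2)[of "(s, t)"] s that by simp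
  qed simp
  have horiz: "log_change g (h t) = H (1, t) - H (0, t)" if t: "t \<in> {0..1}" for t
  proof (rule log_change_eq[of "\<lambda>s. H (s, t)" 1])
    show "continuous_on {0..1} (\<lambda>s. H (s, t))"
      using t by (intro continuous_on_compose2[OF H(1)] continuous_intros) auto
    show "exp (H (s, t)) = 1 * (g s - h t)" if "s \<in> {0..1}" for s
      using H(2)[of "(s, t)"] t that by simp
  qed simp
  show ?thesis
    unfolding pathstart_def pathfinish_def by (simp add: vert horiz)
qed

text \<open>A branch of the logarithm of the difference of two points, normalised so that exchanging
  the points changes it by a sign of \<open>\<i> * pi\<close> that depends only on the order of the indices.\<close>

definition log_diff :: "(nat \<Rightarrow> complex) \<Rightarrow> nat \<Rightarrow> nat \<Rightarrow> complex" where
  "log_diff pos u v = (if u < v then Ln (pos u - pos v) else Ln (pos v - pos u) + \<i> * pi)"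

lemma exp_log_diff: "pos u \<noteq> pos v \<Longrightarrow> exp (log_diff pos u v) = pos u - pos v"
  by (simp add: log_diff_def exp_add)

lemma log_diff_swap:
  "u \<noteq> v \<Longrightarrow> log_diff pos u v - log_diff pos v u = (1 - 2 * of_bool (u < v)) * (\<i> * pi)"
  by (simp add: log_diff_def)

text \<open>The unknowns of the parity condition: \<open>log_diff\<close> predicts the change of the
  logarithm up to whole turns, which this integer counts.\<close>

definition turns :: "(nat \<Rightarrow> complex) \<Rightarrow> (real \<Rightarrow> complex) \<Rightarrow> nat \<Rightarrow> nat \<Rightarrow> nat \<Rightarrow> int" where
  "turns pos g a b v = (SOME n.
     log_change g (pos v) = log_diff pos b v - log_diff pos a v + of_int (2 * n) * pi * \<i>)"

lemma log_change_turns: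
  assumes g: "path g" "pathstart g = pos a" "pathfinish g = pos b" and v: "pos v \<notin> path_image g"
  shows "log_change g (pos v) =
    log_diff pos b v - log_diff pos a v + of_int (2 * turns pos g a b v) * pi * \<i>"
proof -
  have ne: "pos a \<noteq> pos v" "pos b \<noteq> pos v"
    using g v by (metis pathstart_in_path_image pathfinish_in_path_image)+
  then have "exp (log_change g (pos v)) = exp (log_diff pos b v - log_diff pos a v)"
    using g v by (simp add: exp_log_change exp_diff exp_log_diff)
  then have "\<exists>n. log_change g (pos v) = log_diff pos b v - log_diff pos a v + of_int (2 * n) * pi * \<i>"
    unfolding exp_eq .
  then show ?thesis
    unfolding turns_def by (rule someI_ex)
qed

text \<open>Inserting \<open>log_change_turns\<close> into \<open>log_change_disjoint\<close>
  leaves, at each corner of the square, the difference of \<open>log_diff\<close> for the two orders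
  of the points, which is plus or minus i * pi according to the order of the indices.\<close>

lemma even_turns_if_disjoint:
  assumes g: "path g" "pathstart g = pos a" "pathfinish g = pos b"
    and h: "path h" "pathstart h = pos c" "pathfinish h = pos d"
    and disj: "path_image g \<inter> path_image h = {}"
  shows "even (of_bool (b < c) + of_bool (c < a) + of_bool (d < b) + of_bool (a < d) +
    (turns pos g a b c + turns pos g a b d + turns pos h c d a + turns pos h c d b))"
proof -
  have in_g: "pos a \<in> path_image g" "pos b \<in> path_image g"
    using g by (metis pathstart_in_path_image pathfinish_in_path_image)+
  have in_h: "pos c \<in> path_image h" "pos d \<in> path_image h"
    using h by (metis pathstart_in_path_image pathfinish_in_path_image)+
  have off: "pos c \<notin> path_image g" "pos d \<notin> path_image g" "pos a \<notin> path_image h" "pos b \<notin> path_image h"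
    using in_g in_h disj by auto
  then have ne: "b \<noteq> c" "c \<noteq> a" "d \<noteq> b" "a \<noteq> d"
    using in_g in_h by auto
  define K :: int where "K = of_bool (b < c) + of_bool (c < a) + of_bool (d < b) + of_bool (a < d)"
  define T where "T = turns pos g a b c + turns pos h c d b - turns pos h c d a - turns pos g a b d"
  have "(log_diff pos b c - log_diff pos c b) + (log_diff pos c a - log_diff pos a c) +
      (log_diff pos d b - log_diff pos b d) + (log_diff pos a d - log_diff pos d a) +
      of_int (2 * T) * pi * \<i> = 0"
    using log_change_disjoint[OF g(1) h(1) disj]
    unfolding g h log_change_turns[OF g off(1)] log_change_turns[OF g off(2)]
      log_change_turns[OF h off(3)] log_change_turns[OF h off(4)] T_def
    by (simp add: algebra_simps)
  \<comment> \<open>In units of i * pi the four swaps give \<open>4 - 2 * K\<close> and each turn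
    gives 2. The signs inside \<open>T\<close> disappear modulo 2.\<close>
  then have "of_int (2 * T + 4 - 2 * K) * (\<i> * pi) = 0"
    unfolding log_diff_swap[OF ne(1)] log_diff_swap[OF ne(2)] log_diff_swap[OF ne(3)]
      log_diff_swap[OF ne(4)] K_def
    by (simp add: algebra_simps)
  then have "(of_int (2 * T + 4 - 2 * K) :: complex) = 0"
    by simp
  then have "2 * T + 4 - 2 * K = 0"
    by (simp only: of_int_eq_0_iff)
  then have "K = T + 2" by simp
  then show ?thesis
    unfolding K_def[symmetric] by (simp add: T_def)
qed

section \<open>Parity certificates\<close>

text \<open>The number \<open>i < 10\<close> stands for the vertex \<open>X i\<close> and \<open>10 + i\<close> for \<open>Y i\<close>. A block \<open>(es, fs)\<close> of a
  certificate stands for all pairs of an edge in \<open>es\<close> and an edge in \<open>fs\<close>.\<close>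

type_synonym edge = "nat \<times> nat"
type_synonym certificate = "(edge list \<times> edge list) list"

definition edge_list :: "edge list" where
  "edge_list = [(0,1),(1,2),(2,3),(3,4),(4,5),(5,6),(6,7),(7,8),(8,9),(9,0),
     (0,10),(1,11),(2,12),(3,13),(4,14),(5,15),(6,16),(7,17),(8,18),(9,19),
     (10,13),(11,14),(12,15),(13,16),(14,17),(15,18),(16,19),(17,10),(18,11),(19,12)]"

text \<open>The sets of weight 6 consist of the pairs of edges on paths without common end of a subdivision
  of the complete bipartite graph on 3 + 3 vertices. The sets of weight 1 live on the complement of a
  vertex and its neighbours. The sets were found by computer search, the weights by linear
  programming on the orbits of pairs of edges.\<close>

definition certificates :: "(nat \<times> certificate) list" where
  "certificates = [
   (6,
    [([(13, 16), (16, 19), (19, 12)], [(1, 2), (2, 3), (3, 4), (1, 11), (4, 14), (11, 14)]),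
     ([(1, 11), (4, 14), (11, 14)], [(2, 3), (2, 12), (3, 13)]),
     ([(0, 1), (0, 10), (10, 13)], [(2, 3), (3, 4), (4, 5), (2, 12), (5, 15), (12, 15)]),
     ([(4, 5), (5, 15), (12, 15)], [(1, 2), (2, 3), (3, 13)]),
     ([(2, 12)], [(3, 4), (3, 13)]),
     ([(1, 2)], [(3, 4), (3, 13)])]),
   (6,
    [([(3, 13), (13, 16), (16, 19)], [(1, 2), (1, 11), (2, 12), (12, 15), (15, 18), (18, 11)]),
     ([(0, 1), (9, 0), (9, 19)], [(2, 3), (3, 4), (4, 5), (2, 12), (5, 15), (12, 15)]),
     ([(12, 15)], [(1, 2), (2, 3)]),
     ([(1, 11), (15, 18), (18, 11)], [(2, 3), (2, 12), (19, 12)]),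
     ([(3, 4), (4, 5), (5, 15)], [(1, 2), (2, 12), (19, 12)]),
     ([(19, 12)], [(1, 2), (2, 3)])]),
   (6,
    [([(7, 8), (8, 18), (18, 11)], [(3, 4), (3, 13), (4, 14), (10, 13), (14, 17), (17, 10)]),
     ([(0, 1), (0, 10), (1, 11)], [(4, 5), (5, 6), (6, 7), (4, 14), (7, 17), (14, 17)]),
     ([(4, 5), (5, 6), (6, 7)], [(11, 14), (14, 17), (17, 10)]),
     ([(3, 4), (3, 13), (10, 13)], [(7, 17), (11, 14), (14, 17)]),
     ([(7, 17)], [(4, 14), (11, 14)]),
     ([(17, 10)], [(4, 14), (11, 14)])]),
   (1,
    [([(3, 4)], [(0, 1), (1, 2), (0, 10), (2, 12), (10, 13), (13, 16), (16, 19), (19, 12)]),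
     ([(4, 5), (5, 15)], [(2, 3), (2, 12), (3, 13), (13, 16), (16, 19), (19, 12)]),
     ([(15, 18), (18, 11)], [(0, 1), (1, 2), (9, 0), (2, 12), (9, 19), (19, 12)]),
     ([(1, 11)], [(2, 3), (9, 0), (0, 10), (2, 12), (3, 13), (9, 19), (10, 13), (19, 12)]),
     ([(4, 14), (11, 14)], [(0, 1), (1, 2), (2, 3), (0, 10), (3, 13), (10, 13)]),
     ([(1, 2)], [(9, 0), (0, 10), (3, 13), (9, 19), (10, 13), (12, 15), (19, 12)]),
     ([(2, 3)], [(0, 1), (0, 10), (10, 13), (12, 15), (13, 16), (16, 19), (19, 12)]),
     ([(2, 12)], [(0, 1), (9, 0), (3, 13), (9, 19), (13, 16), (16, 19)]),
     ([(12, 15)], [(0, 1), (9, 0), (3, 13), (9, 19), (13, 16), (16, 19)])]),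
   (1,
    [([(11, 14)], [(0, 1), (1, 2), (2, 3), (3, 4), (4, 5), (7, 8), (0, 10), (5, 15), (7, 17), (8, 18), (15, 18), (17, 10)]),
     ([(15, 18)], [(0, 1), (7, 8), (8, 9), (9, 0), (1, 11), (7, 17), (14, 17)]),
     ([(2, 12), (12, 15)], [(0, 1), (8, 9), (9, 0), (1, 11), (8, 18), (18, 11)]),
     ([(4, 14)], [(0, 1), (7, 8), (0, 10), (1, 11), (7, 17), (8, 18), (17, 10), (18, 11)]),
     ([(2, 3), (3, 4)], [(0, 1), (0, 10), (1, 11), (14, 17), (17, 10)]),
     ([(1, 11)], [(8, 9), (9, 0), (0, 10), (8, 18), (14, 17), (17, 10)]),
     ([(4, 5), (5, 15)], [(7, 8), (7, 17), (8, 18), (14, 17), (18, 11)]),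
     ([(18, 11)], [(0, 1), (1, 2), (7, 8), (8, 9), (9, 0), (7, 17), (14, 17)]),
     ([(1, 2)], [(8, 9), (9, 0), (0, 10), (8, 18), (14, 17), (17, 10)])])]"

definition cert_pairs :: "certificate \<Rightarrow> (edge \<times> edge) list" where
  "cert_pairs C = concat (map (\<lambda>(es, fs). List.product es fs) C)"

definition partners :: "certificate \<Rightarrow> edge \<Rightarrow> edge list" where
  "partners C e =
     concat (map (\<lambda>(es, fs). (if e \<in> set es then fs else []) @ (if e \<in> set fs then es else [])) C)"

lemma [termination_simp]: "length (remove1 x xs) < Suc (length xs)"
  by (simp add: length_remove1 less_Suc_eq_le)

fun all_even :: "'a list \<Rightarrow> bool" where
  "all_even [] \<longleftrightarrow> True"
| "all_even (x # xs) \<longleftrightarrow> x \<in> set xs \<and> all_even (remove1 x xs)"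

text \<open>Two pairs of numbers are interleaved iff chords joining points in convex position in this order
  would cross.\<close>

fun interleaved :: "edge \<times> edge \<Rightarrow> bool" where
  "interleaved ((a, b), (c, d)) \<longleftrightarrow> (((b < c) = (c < a)) \<noteq> ((d < b) = (a < d)))"

fun independent_edges :: "edge \<times> edge \<Rightarrow> bool" where
  "independent_edges ((a, b), (c, d)) \<longleftrightarrow> a \<noteq> c \<and> a \<noteq> d \<and> b \<noteq> c \<and> b \<noteq> d"

text \<open>The third condition cancels the unknowns: for each edge \<open>e\<close>, every vertex
  is an end of an even number of partners of \<open>e\<close>. The last condition makes the known
  part odd.\<close>

definition odd_certificate :: "certificate \<Rightarrow> bool" where
  "odd_certificate C \<longleftrightarrow>
     list_all (\<lambda>(es, fs). distinct es \<and> distinct fs \<and>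
       list_all (\<lambda>e. e \<in> set edge_list) es \<and> list_all (\<lambda>e. e \<in> set edge_list) fs) C \<and>
     list_all independent_edges (cert_pairs C) \<and>
     list_all (\<lambda>e. all_even (concat (map (\<lambda>(c, d). [c, d]) (partners C e)))) edge_list \<and>
     odd (length (filter interleaved (cert_pairs C)))"

fun rotate_vertex :: "nat \<Rightarrow> nat" where
  "rotate_vertex v = (if v = 9 then 0 else if v = 19 then 10 else v + 1)"

text \<open>The automorphism adding 1 to the indices of both kinds of vertices. The directions in
  \<open>edge_list\<close> are such that it maps entries to entries and never to a reversed
  entry.\<close>

definition rotate_edge :: "edge \<Rightarrow> edge" where
  "rotate_edge = map_prod rotate_vertex rotate_vertex"

text \<open>The partners of the rotated edge are listed once for all \<open>f\<close>, since rewriting does not share the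
  results of repeated calls.\<close>

definition partner_rows :: "edge \<Rightarrow> (nat \<times> (nat \<times> edge list) list) list" where
  "partner_rows e = map (\<lambda>j. (j, map (\<lambda>(w, C). (w, partners C ((rotate_edge ^^ j) e))) certificates)) [0..<10]"

definition row_load :: "(nat \<times> (nat \<times> edge list) list) list \<Rightarrow> edge \<Rightarrow> nat" where
  "row_load R f = (\<Sum>(j, ps)\<leftarrow>R. \<Sum>(w, es)\<leftarrow>ps. if (rotate_edge ^^ j) f \<in> set es then w else 0)"

definition bounded_row :: "(nat \<times> (nat \<times> edge list) list) list \<Rightarrow> bool" where
  "bounded_row R \<longleftrightarrow> list_all (\<lambda>f. row_load R f \<le> 36) edge_list"


section \<open>Finite checks on the certificates\<close>

lemma certificates_odd: "list_all (\<lambda>(w, C). odd_certificate C) certificates"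
  by code_simp

text \<open>One edge from each rotation orbit (outer cycle, spokes, inner edges) suffices as the
  first edge of the pair.\<close>

lemma load_check: "list_all (\<lambda>e. bounded_row (partner_rows e)) [(0,1),(0,10),(10,13)]"
  by code_simp

section \<open>Summing the parity conditions over a certificate\<close>

lemma even_sum_list: "(\<And>x. x \<in> set xs \<Longrightarrow> even (h x)) \<Longrightarrow> even (\<Sum>x\<leftarrow>xs. h x :: int)"
  by (induction xs) auto

lemma even_sum_list_iff: "even (\<Sum>x\<leftarrow>xs. h x :: int) \<longleftrightarrow> even (length (filter (\<lambda>x. odd (h x)) xs))"
  by (induction xs) auto

lemma even_sum_list_all_even: "all_even xs \<Longrightarrow> even (\<Sum>x\<leftarrow>xs. h x :: int)"
proof (induction xs rule: all_even.induct)
  case (2 x xs)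
  then have "(\<Sum>x\<leftarrow>xs. h x) = h x + (\<Sum>x\<leftarrow>remove1 x xs. h x)"
    by (intro sum_list_map_remove1) simp
  with 2 show ?case by simp
qed simp

lemma sum_list_product: "(\<Sum>p\<leftarrow>List.product xs ys. h p) = (\<Sum>x\<leftarrow>xs. \<Sum>y\<leftarrow>ys. h (x, y))"
  by (induction xs) (simp_all add: comp_def)

lemma sum_list_sum_swap: "(\<Sum>x\<leftarrow>xs. \<Sum>y\<in>A. h x y) = (\<Sum>y\<in>A. \<Sum>x\<leftarrow>xs. h x y)"
  by (induction xs) (simp_all add: sum.distrib)

lemma sum_list_eq_sum_if:
  assumes "distinct es" "set es \<subseteq> A" "finite A"
  shows "(\<Sum>e\<leftarrow>es. h e) = (\<Sum>x\<in>A. if x \<in> set es then h x else 0)"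
  using assms by (simp add: sum_list_distinct_conv_sum_set sum.If_cases Int_absorb1)

text \<open>Double counting: a pair contributes one term for each of its edges as first argument of
  \<open>m\<close>, and the terms are regrouped by this first argument. Distinctness within blocks
  turns list sums into sums over \<open>A\<close>.\<close>

lemma sum_cert_pairs:
  assumes "list_all (\<lambda>(es, fs). distinct es \<and> distinct fs \<and> set es \<subseteq> A \<and> set fs \<subseteq> A) C" "finite A"
  shows "(\<Sum>(e, f)\<leftarrow>cert_pairs C. m e f + m f e) = (\<Sum>x\<in>A. \<Sum>y\<leftarrow>partners C x. m x y :: int)"
  using assms(1)
proof (induction C)
  case Nil
  then show ?case by (simp add: cert_pairs_def partners_def)
next
  case (Cons B C)
  obtain es fs where B: "B = (es, fs)" by fastforce
  have "(\<Sum>(e, f)\<leftarrow>List.product es fs. m e f + m f e) =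
      (\<Sum>e\<leftarrow>es. \<Sum>f\<leftarrow>fs. m e f) + (\<Sum>e\<leftarrow>es. \<Sum>f\<leftarrow>fs. m f e)"
    by (simp add: sum_list_product sum_list_addf)
  also have "(\<Sum>e\<leftarrow>es. \<Sum>f\<leftarrow>fs. m f e) = (\<Sum>f\<leftarrow>fs. \<Sum>e\<leftarrow>es. m f e)"
    by (induction es) (simp_all add: sum_list_addf)
  finally have "(\<Sum>(e, f)\<leftarrow>List.product es fs. m e f + m f e) =
      (\<Sum>x\<in>A. \<Sum>y\<leftarrow>(if x \<in> set es then fs else []) @ (if x \<in> set fs then es else []). m x y)"
    using Cons.prems assms(2) B
    by (auto simp: sum_list_eq_sum_if[of es A "\<lambda>e. \<Sum>f\<leftarrow>fs. m e f"]
        sum_list_eq_sum_if[of fs A "\<lambda>f. \<Sum>e\<leftarrow>es. m f e"] simp flip: sum.distrib intro!: sum.cong)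
  then show ?case
    using Cons B by (simp add: cert_pairs_def partners_def sum.distrib)
qed

definition joins :: "(nat \<Rightarrow> complex) \<Rightarrow> (edge \<Rightarrow> real \<Rightarrow> complex) \<Rightarrow> bool" where
  "joins pos g \<longleftrightarrow> (\<forall>e \<in> set edge_list.
     path (g e) \<and> pathstart (g e) = pos (fst e) \<and> pathfinish (g e) = pos (snd e))"

text \<open>If all pairs were disjoint, their parity conditions would add up to an even number. The
  unknowns cancel, so the number of interleaved pairs would be even.\<close>

lemma odd_certificate_hit:
  assumes C: "odd_certificate C" and g: "joins pos g"
  shows "\<exists>e f. (e, f) \<in> set (cert_pairs C) \<and> path_image (g e) \<inter> path_image (g f) \<noteq> {}"
proof (rule ccontr)
  assume "\<not> ?thesis"
  then have disj: "path_image (g e) \<inter> path_image (g f) = {}" if "(e, f) \<in> set (cert_pairs C)" for e f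
    using that by blast
  \<comment> \<open>\<open>n v e\<close> is the unknown for vertex \<open>v\<close> and edge
    \<open>e\<close>; \<open>m e f\<close> collects those of \<open>e\<close> about the two ends of
    \<open>f\<close>; \<open>K\<close> is the known part.\<close>
  define n where "n v e = turns pos (g e) (fst e) (snd e) v" for v e
  define m where "m e f = n (fst f) e + n (snd f) e" for e f
  define K :: "edge \<times> edge \<Rightarrow> int" where
    "K = (\<lambda>((a, b), (c, d)). of_bool (b < c) + of_bool (c < a) + of_bool (d < b) + of_bool (a < d))"
  have blocks: "list_all (\<lambda>(es, fs). distinct es \<and> distinct fs \<and>
      set es \<subseteq> set edge_list \<and> set fs \<subseteq> set edge_list) C"
    using C unfolding odd_certificate_def list_all_iff by (auto simp: subset_iff)
  then have in_edges: "e \<in> set edge_list" "f \<in> set edge_list" if "(e, f) \<in> set (cert_pairs C)" for e f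
    using that by (force simp: cert_pairs_def list_all_iff)+
  have "even (\<Sum>p\<leftarrow>cert_pairs C. K p + (case p of (e, f) \<Rightarrow> m e f + m f e))"
  proof (rule even_sum_list)
    fix p assume p: "p \<in> set (cert_pairs C)"
    obtain a b c d where p_eq: "p = ((a, b), (c, d))" by (metis surj_pair)
    have "even (of_bool (b < c) + of_bool (c < a) + of_bool (d < b) + of_bool (a < d) +
      (turns pos (g (a, b)) a b c + turns pos (g (a, b)) a b d +
       turns pos (g (c, d)) c d a + turns pos (g (c, d)) c d b))"
      using g in_edges[of "(a, b)" "(c, d)"] disj[of "(a, b)" "(c, d)"] p
      unfolding joins_def p_eq by (intro even_turns_if_disjoint) auto
    then show "even (K p + (case p of (e, f) \<Rightarrow> m e f + m f e))"
      unfolding p_eq K_def m_def n_def by (simp add: algebra_simps)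
  qed
  \<comment> \<open>Grouped by \<open>e\<close>, the unknowns \<open>n v e\<close> run over the ends
    of all partners of \<open>e\<close>, where each vertex occurs an even number of times.\<close>
  moreover have "even (\<Sum>(e, f)\<leftarrow>cert_pairs C. m e f + m f e)"
    unfolding sum_cert_pairs[OF blocks finite_set]
  proof (rule dvd_sum)
    fix e assume "e \<in> set edge_list"
    then have "all_even (concat (map (\<lambda>(c, d). [c, d]) (partners C e)))"
      using C unfolding odd_certificate_def list_all_iff by blast
    then have "even (\<Sum>v\<leftarrow>concat (map (\<lambda>(c, d). [c, d]) (partners C e)). n v e)"
      by (rule even_sum_list_all_even)
    also have "(\<Sum>v\<leftarrow>concat (map (\<lambda>(c, d). [c, d]) xs). n v e) = (\<Sum>f\<leftarrow>xs. m e f)" for xs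
      by (induction xs) (auto simp: m_def)
    finally show "even (\<Sum>f\<leftarrow>partners C e. m e f)" .
  qed
  ultimately have "even (\<Sum>p\<leftarrow>cert_pairs C. K p)"
    by (simp add: sum_list_addf)
  moreover have "odd (K p) \<longleftrightarrow> interleaved p" for p
    by (cases p rule: interleaved.cases) (auto simp: K_def)
  ultimately have "even (length (filter interleaved (cert_pairs C)))"
    by (simp add: even_sum_list_iff)
  then show False
    using C unfolding odd_certificate_def by blast
qed

section \<open>Rotational symmetry\<close>

lemma rotate_edge_in: "e \<in> set edge_list \<Longrightarrow> (rotate_edge ^^ j) e \<in> set edge_list"
proof (induction j)
  case (Suc j)
  moreover have "\<forall>e \<in> set edge_list. rotate_edge e \<in> set edge_list"
    by (simp add: edge_list_def rotate_edge_def)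
  ultimately show ?case by simp
qed simp

lemma rotate_edge_period: "e \<in> set edge_list \<Longrightarrow> (rotate_edge ^^ 10) e = e"
  by (auto simp: edge_list_def rotate_edge_def eval_nat_numeral)

lemma rotate_edge_orbit:
  assumes "e \<in> set edge_list"
  shows "\<exists>i<10. \<exists>r\<in>{(0,1),(0,10),(10,13)}. e = (rotate_edge ^^ i) r"
proof -
  have "list_all (\<lambda>e. list_ex (\<lambda>i. list_ex (\<lambda>r. e = (rotate_edge ^^ i) r) [(0,1),(0,10),(10,13)]) [0..<10]) edge_list"
    by code_simp
  with assms show ?thesis
    unfolding list_all_iff list_ex_iff by fastforce
qed

text \<open>Relabelling by an automorphism preserves the hypothesis on the paths, so each
  certificate also obstructs in all its rotated positions.\<close>

lemma joins_rotate:
  assumes "joins pos g"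
  shows "joins (pos \<circ> (rotate_vertex ^^ j)) (g \<circ> (rotate_edge ^^ j))"
proof -
  have "(rotate_edge ^^ j) e = ((rotate_vertex ^^ j) (fst e), (rotate_vertex ^^ j) (snd e))" for e
    by (induction j arbitrary: e) (auto simp: rotate_edge_def map_prod_def split: prod.splits)
  then show ?thesis
    using assms rotate_edge_in unfolding joins_def by (metis comp_apply fst_conv snd_conv)
qed

text \<open>A common end stays a common end under rotation.\<close>

lemma independent_rotate: "independent_edges ((rotate_edge ^^ j) e, (rotate_edge ^^ j) f) \<Longrightarrow> independent_edges (e, f)"
proof (induction j arbitrary: e f)
  case (Suc j)
  then have "independent_edges (rotate_edge e, rotate_edge f)"
    by (metis comp_apply funpow_Suc_right)
  then show ?case
    by (cases "(e, f)" rule: independent_edges.cases) (auto simp: rotate_edge_def split: if_splits)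
qed simp

text \<open>The total weight of the rotated certificates containing the pair. The pair is rotated
  forward in place of rotating each certificate backward.\<close>

definition load :: "edge \<Rightarrow> edge \<Rightarrow> nat" where
  "load e f = (\<Sum>j<10. \<Sum>(w, C)\<leftarrow>certificates.
     if (rotate_edge ^^ j) f \<in> set (partners C ((rotate_edge ^^ j) e)) then w else 0)"

lemma row_load_partner_rows: "row_load (partner_rows e) f = load e f"
proof -
  have "row_load (partner_rows e) f = (\<Sum>j\<leftarrow>[0..<10]. \<Sum>(w, C)\<leftarrow>certificates.
     if (rotate_edge ^^ j) f \<in> set (partners C ((rotate_edge ^^ j) e)) then w else 0)"
    unfolding row_load_def partner_rows_def by (simp add: comp_def case_prod_unfold cong: if_cong)
  then show ?thesis
    unfolding load_def by (simp add: interv_sum_list_conv_sum_set_nat atLeast0LessThan)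
qed

text \<open>The summand has period 10 in \<open>j\<close>, so shifting the summation index by one
  leaves the sum unchanged.\<close>

lemma load_rotate:
  assumes "e \<in> set edge_list" "f \<in> set edge_list"
  shows "load ((rotate_edge ^^ i) e) ((rotate_edge ^^ i) f) = load e f"
proof (induction i)
  case (Suc i)
  define e' f' where "e' = (rotate_edge ^^ i) e" and "f' = (rotate_edge ^^ i) f"
  define \<phi> where "\<phi> j = (\<Sum>(w, C)\<leftarrow>certificates.
     if (rotate_edge ^^ j) f' \<in> set (partners C ((rotate_edge ^^ j) e')) then w else 0)" for j
  have "\<phi> 10 = \<phi> 0"
    unfolding \<phi>_def e'_def f'_def using assms by (simp add: rotate_edge_period rotate_edge_in)
  then have "(\<Sum>j<10. \<phi> (Suc j)) = (\<Sum>j<10. \<phi> j)"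
    using sum.lessThan_Suc_shift[of \<phi> 10] sum.lessThan_Suc[of \<phi> 10] by simp
  moreover have "load (rotate_edge e') (rotate_edge f') = (\<Sum>j<10. \<phi> (Suc j))"
    unfolding load_def \<phi>_def by (simp only: funpow_Suc_right comp_apply)
  moreover have "load e' f' = (\<Sum>j<10. \<phi> j)"
    unfolding load_def \<phi>_def ..
  ultimately show ?case
    using Suc by (simp add: e'_def f'_def)
qed simp

lemma load_le:
  assumes e: "e \<in> set edge_list" and f: "f \<in> set edge_list"
  shows "load e f \<le> 36"
proof -
  obtain i r where i: "i < 10" and r: "r \<in> {(0,1),(0,10),(10,13)}" and e_eq: "e = (rotate_edge ^^ i) r"
    using rotate_edge_orbit[OF e] by blast
  \<comment> \<open>Rotating back by \<open>i\<close> is expressed as rotating forward by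
    \<open>10 - i\<close>, as ten rotations are the identity on edges.\<close>
  define f' where "f' = (rotate_edge ^^ (10 - i)) f"
  have "(rotate_edge ^^ i) f' = (rotate_edge ^^ (i + (10 - i))) f"
    unfolding f'_def by (simp add: funpow_add)
  also have "i + (10 - i) = 10"
    using i by simp
  finally have f_eq: "(rotate_edge ^^ i) f' = f"
    using rotate_edge_period[OF f] by simp
  have f': "f' \<in> set edge_list"
    unfolding f'_def by (rule rotate_edge_in[OF f])
  have "r \<in> set edge_list"
    using r by (auto simp: edge_list_def)
  then have "load e f = load r f'"
    using load_rotate[of r f' i] f' by (simp add: e_eq f_eq)
  also have "\<dots> \<le> 36"
    using load_check r f' unfolding list_all_iff bounded_row_def row_load_partner_rows by auto
  finally show ?thesis .
qed

section \<open>Weighted counting of crossing pairs\<close>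

definition crossing_pairs :: "(edge \<Rightarrow> real \<Rightarrow> complex) \<Rightarrow> edge set set" where
  "crossing_pairs g = {{e, f} | e f. e \<in> set edge_list \<and> f \<in> set edge_list \<and>
     independent_edges (e, f) \<and> path_image (g e) \<inter> path_image (g f) \<noteq> {}}"

lemma finite_crossing_pairs: "finite (crossing_pairs g)"
  by (rule finite_subset[of _ "Pow (set edge_list)"]) (auto simp: crossing_pairs_def)

text \<open>The obstruction is applied to the paths relabelled by \<open>10 - j\<close> rotations.
  The pair found there is met in \<open>g\<close> after \<open>10 - j\<close> rotations, and
  \<open>j\<close> further ones bring it back into \<open>C\<close>.\<close>

lemma certificate_hits_crossing_pair:
  assumes g: "joins pos g" and C: "(w, C) \<in> set certificates" and j: "j < 10"
  shows "\<exists>e f. {e, f} \<in> crossing_pairs g \<and> ((rotate_edge ^^ j) e, (rotate_edge ^^ j) f) \<in> set (cert_pairs C)"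
proof -
  have odd: "odd_certificate C"
    using certificates_odd C unfolding list_all_iff by auto
  obtain e f where ef: "(e, f) \<in> set (cert_pairs C)"
    and meet: "path_image (g ((rotate_edge ^^ (10 - j)) e)) \<inter> path_image (g ((rotate_edge ^^ (10 - j)) f)) \<noteq> {}"
    using odd_certificate_hit[OF odd joins_rotate[OF g, of "10 - j"]]
    unfolding comp_apply by blast
  have in_edges: "e \<in> set edge_list" "f \<in> set edge_list"
    using odd ef unfolding odd_certificate_def list_all_iff cert_pairs_def by auto
  have rot_back: "(rotate_edge ^^ j) ((rotate_edge ^^ (10 - j)) x) = x" if "x \<in> set edge_list" for x
  proof -
    have "(rotate_edge ^^ j) ((rotate_edge ^^ (10 - j)) x) = (rotate_edge ^^ (j + (10 - j))) x"
      by (simp add: funpow_add)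
    also have "j + (10 - j) = 10"
      using j by simp
    finally show ?thesis
      using rotate_edge_period[OF that] by simp
  qed
  let ?e = "(rotate_edge ^^ (10 - j)) e" and ?f = "(rotate_edge ^^ (10 - j)) f"
  have "independent_edges ((rotate_edge ^^ j) ?e, (rotate_edge ^^ j) ?f)"
    unfolding rot_back[OF in_edges(1)] rot_back[OF in_edges(2)]
    using odd ef unfolding odd_certificate_def list_all_iff by blast
  then have "independent_edges (?e, ?f)"
    by (rule independent_rotate)
  then have "{?e, ?f} \<in> crossing_pairs g"
    using meet in_edges rotate_edge_in unfolding crossing_pairs_def by blast
  moreover have "((rotate_edge ^^ j) ?e, (rotate_edge ^^ j) ?f) \<in> set (cert_pairs C)"
    unfolding rot_back[OF in_edges(1)] rot_back[OF in_edges(2)] by (rule ef)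
  ultimately show ?thesis by blast
qed

text \<open>Every rotated certificate contains a crossing pair, so the total weight 10 * (6 + 6 + 6
  + 1 + 1) = 200 is at most 36 times the number of crossing pairs, whereas 5 * 36 = 180.\<close>

lemma six_crossing_pairs:
  assumes g: "joins pos g"
  shows "6 \<le> card (crossing_pairs g)"
proof -
  let ?U = "crossing_pairs g"
  define hit where "hit j C P \<longleftrightarrow> (\<exists>e f. P = {e, f} \<and>
      ((rotate_edge ^^ j) e, (rotate_edge ^^ j) f) \<in> set (cert_pairs C))" for j C P
  have "(\<Sum>j<(10::nat). \<Sum>(w, C)\<leftarrow>certificates. w) \<le>
      (\<Sum>j<10. \<Sum>(w, C)\<leftarrow>certificates. \<Sum>P\<in>?U. if hit j C P then w else 0)"
  proof (intro sum_mono sum_list_mono)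
    fix j p assume j: "j \<in> {..<10::nat}" and p: "p \<in> set certificates"
    obtain w C where p_eq: "p = (w, C)" by fastforce
    obtain P where "P \<in> ?U" "hit j C P"
      using certificate_hits_crossing_pair[OF g] j p unfolding hit_def p_eq by (metis lessThan_iff)
    then show "(case p of (w, C) \<Rightarrow> w) \<le>
        (case p of (w, C) \<Rightarrow> \<Sum>P\<in>?U. if hit j C P then w else 0)"
      using member_le_sum[of P ?U "\<lambda>P. if hit j C P then w else 0"] finite_crossing_pairs
      by (simp add: p_eq)
  qed
  also have "\<dots> = (\<Sum>P\<in>?U. \<Sum>j<10. \<Sum>(w, C)\<leftarrow>certificates. if hit j C P then w else 0)"
    by (simp add: case_prod_unfold sum_list_sum_swap sum.swap[of _ ?U])
  also have "\<dots> \<le> (\<Sum>P\<in>?U. 36)"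
  proof (rule sum_mono)
    fix P assume "P \<in> ?U"
    then obtain e f where P: "P = {e, f}" and ef: "e \<in> set edge_list" "f \<in> set edge_list"
      unfolding crossing_pairs_def by auto
    \<comment> \<open>\<open>P\<close> is unordered, so \<open>e\<close> may be either member of the
      certified pair; \<open>partners\<close> is symmetric and covers both cases.\<close>
    have "(rotate_edge ^^ j) f \<in> set (partners C ((rotate_edge ^^ j) e))" if "hit j C P" for j C
    proof -
      from that consider "((rotate_edge ^^ j) e, (rotate_edge ^^ j) f) \<in> set (cert_pairs C)"
        | "((rotate_edge ^^ j) f, (rotate_edge ^^ j) e) \<in> set (cert_pairs C)"
        unfolding hit_def P by (auto simp: doubleton_eq_iff)
      then show ?thesis
        by cases (force simp: cert_pairs_def partners_def)+
    qed
    then have "(\<Sum>j<10. \<Sum>(w, C)\<leftarrow>certificates. if hit j C P then w else 0) \<le> load e f"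
      unfolding load_def by (intro sum_mono sum_list_mono) auto
    also have "\<dots> \<le> 36"
      by (rule load_le[OF ef])
    finally show "(\<Sum>j<10. \<Sum>(w, C)\<leftarrow>certificates. if hit j C P then w else 0) \<le> 36" .
  qed
  finally show ?thesis
    by (simp add: certificates_def)
qed

section \<open>Six crossings are necessary\<close>

definition vertex :: "nat \<Rightarrow> gp_vertex" where
  "vertex v = (if v < 10 then X v else Y (v - 10))"

definition edge_set :: "edge \<Rightarrow> gp_vertex set" where
  "edge_set e = {vertex (fst e), vertex (snd e)}"

lemma inj_vertex: "inj vertex"
  by (rule injI) (auto simp: vertex_def split: if_splits)

lemma gp_vertices_10: "gp_vertices 10 = vertex ` {..<20}"
proof
  have "X i = vertex i" "Y i = vertex (i + 10)" if "i < 10" for i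
    using that by (simp_all add: vertex_def)
  then show "gp_vertices 10 \<subseteq> vertex ` {..<20}"
    unfolding gp_vertices_def by fastforce
  show "vertex ` {..<20} \<subseteq> gp_vertices 10"
    unfolding gp_vertices_def by (auto simp: vertex_def)
qed

lemma gp_edges_10_3: "gp_edges 10 3 = edge_set ` set edge_list"
proof -
  have *: "{f i | i. i < (10::nat)} = f ` set [0..<10]" for f :: "nat \<Rightarrow> gp_vertex set"
    by auto
  have "set [0..<10] = {0, 1, 2, 3, 4, 5, 6, 7, 8, 9::nat}"
    by (simp add: upt_rec numeral_eq_Suc) 
  then show ?thesis
    unfolding gp_edges_def * edge_list_def by (simp add: edge_set_def vertex_def insert_commute flip: numeral_2_eq_2)
qed

text \<open>That no edge is listed in both directions makes \<open>edge_set\<close> injective on the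
  list.\<close>

lemma edge_list_proper:
  "(a, b) \<in> set edge_list \<Longrightarrow> a < 20 \<and> b < 20 \<and> a \<noteq> b \<and> (b, a) \<notin> set edge_list"
proof -
  have "list_all (\<lambda>(a, b). a < 20 \<and> b < 20 \<and> a \<noteq> b \<and> (b, a) \<notin> set edge_list) edge_list"
    by code_simp
  then show "(a, b) \<in> set edge_list \<Longrightarrow> ?thesis"
    unfolding list_all_iff by auto
qed

lemma inj_on_edge_set: "inj_on edge_set (set edge_list)"
proof (rule inj_onI)
  fix e f assume e: "e \<in> set edge_list" and f: "f \<in> set edge_list" and eq: "edge_set e = edge_set f"
  obtain a b c d where ef: "e = (a, b)" "f = (c, d)" by fastforce
  show "e = f"
    using eq e f edge_list_proper[of a b] unfolding ef edge_set_def
    by (auto simp: doubleton_eq_iff inj_eq[OF inj_vertex])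
qed

lemma crossing_number_lower:
  assumes D: "is_drawing (gp_vertices 10) (gp_edges 10 3) pos \<gamma>"
  shows "6 \<le> card (crossings (gp_edges 10 3) \<gamma>)"
proof -
  let ?V = "gp_vertices 10" and ?E = "gp_edges 10 3"
  define P where "P = pos \<circ> vertex"
  \<comment> \<open>A drawing gives the ends of a curve only as a set; each curve is reversed where
    necessary to follow the direction in \<open>edge_list\<close>.\<close>
  define g where "g e = (if pathstart (\<gamma> (edge_set e)) = P (fst e) then \<gamma> (edge_set e)
    else reversepath (\<gamma> (edge_set e)))" for e
  have inj: "inj_on pos ?V" and fin: "finite (crossings ?E \<gamma>)"
    and arcs: "\<And>e. e \<in> ?E \<Longrightarrow> arc (\<gamma> e)"
    and ends: "\<And>e. e \<in> ?E \<Longrightarrow> {pathstart (\<gamma> e), pathfinish (\<gamma> e)} = pos ` e"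
    and only: "\<And>e. e \<in> ?E \<Longrightarrow> path_image (\<gamma> e) \<inter> pos ` ?V = pos ` e"
    using D by (simp_all add: is_drawing_def)
  have in_E: "edge_set e \<in> ?E" if "e \<in> set edge_list" for e
    using that unfolding gp_edges_10_3 by blast
  have image_g: "path_image (g e) = path_image (\<gamma> (edge_set e))" for e
    by (simp add: g_def)
  have "joins P g"
    unfolding joins_def
  proof
    fix e assume e: "e \<in> set edge_list"
    have "path (\<gamma> (edge_set e))"
      using arcs[OF in_E[OF e]] by (rule arc_imp_path)
    moreover have "{pathstart (\<gamma> (edge_set e)), pathfinish (\<gamma> (edge_set e))} = {P (fst e), P (snd e)}"
      using ends[OF in_E[OF e]] by (simp add: edge_set_def P_def)
    ultimately show "path (g e) \<and> pathstart (g e) = P (fst e) \<and> pathfinish (g e) = P (snd e)"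
      unfolding g_def by (auto simp: doubleton_eq_iff)
  qed
  then have "6 \<le> card (crossing_pairs g)"
    by (rule six_crossing_pairs)
  also have "card (crossing_pairs g) = card ((`) edge_set ` crossing_pairs g)"
  proof (rule card_image[symmetric], rule inj_on_subset)
    show "inj_on ((`) edge_set) (Pow (set edge_list))"
      by (rule inj_on_image_Pow[OF inj_on_edge_set])
  qed (auto simp: crossing_pairs_def)
  also have "\<dots> \<le> card (fst ` crossings ?E \<gamma>)"
  proof (rule card_mono)
    show "finite (fst ` crossings ?E \<gamma>)"
      using fin by simp
    show "(`) edge_set ` crossing_pairs g \<subseteq> fst ` crossings ?E \<gamma>"
    proof
      fix Q assume "Q \<in> (`) edge_set ` crossing_pairs g"
      then obtain R where R: "R \<in> crossing_pairs g" and Q_image: "Q = edge_set ` R"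
        by blast
      from R obtain e f where R_eq: "R = {e, f}" and e: "e \<in> set edge_list" and f: "f \<in> set edge_list"
        and ind: "independent_edges (e, f)" and meet: "path_image (g e) \<inter> path_image (g f) \<noteq> {}"
        unfolding crossing_pairs_def by blast
      have Q: "Q = {edge_set e, edge_set f}"
        unfolding Q_image R_eq by simp
      obtain p where p: "p \<in> path_image (\<gamma> (edge_set e))" "p \<in> path_image (\<gamma> (edge_set f))"
        using meet unfolding image_g by blast
      have disj: "edge_set e \<inter> edge_set f = {}"
        using ind by (cases "(e, f)" rule: independent_edges.cases)
          (auto simp: edge_set_def inj_eq[OF inj_vertex])
      have sub: "edge_set e \<subseteq> ?V" "edge_set f \<subseteq> ?V"
        using e f edge_list_proper[of "fst e" "snd e"] edge_list_proper[of "fst f" "snd f"]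
        by (auto simp: edge_set_def gp_vertices_10)
      have "pos ` edge_set e \<inter> pos ` edge_set f = {}"
        using inj_on_image_Int[OF inj sub] disj by simp
      \<comment> \<open>A vertex point on both curves would be the image of an end of both edges,
        but these are disjoint.\<close>
      then have "p \<notin> pos ` ?V"
        using p only[OF in_E[OF e]] only[OF in_E[OF f]] by blast
      then have "p \<notin> pos ` edge_set e" "p \<notin> pos ` edge_set f"
        using sub by blast+
      then have "p \<in> curve_interior (\<gamma> (edge_set e)) \<inter> curve_interior (\<gamma> (edge_set f))"
        using p unfolding curve_interior_def ends[OF in_E[OF e]] ends[OF in_E[OF f]] by blast
      moreover have "edge_set e \<noteq> edge_set f"
        using disj by (auto simp: edge_set_def)
      ultimately have "(Q, p) \<in> crossings ?E \<gamma>"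
        unfolding crossings_def Q using in_E[OF e] in_E[OF f] by blast
      then show "Q \<in> fst ` crossings ?E \<gamma>"
        by force
    qed
  qed
  \<comment> \<open>Projecting a crossing to its pair of edges can only lower the count, so several
    crossings of the same two edges do no harm.\<close>
  also have "\<dots> \<le> card (crossings ?E \<gamma>)"
    by (rule card_image_le[OF fin])
  finally show ?thesis .
qed

section \<open>Crossings of line segments\<close>

text \<open>The planar determinant. On \<open>b - a\<close> and \<open>c - a\<close> it is twice the
  signed area of the triangle \<open>a\<close>, \<open>b\<close>, \<open>c\<close>.\<close>

definition cross :: "complex \<Rightarrow> complex \<Rightarrow> real" where
  "cross u v = Re u * Im v - Im u * Re v"

lemma cross_segment_zero: "z \<in> closed_segment a b \<Longrightarrow> cross (b - a) (z - a) = 0"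
  unfolding in_segment
proof clarify
  fix t :: real
  show "cross (b - a) ((1 - t) *\<^sub>R a + t *\<^sub>R b - a) = 0"
    by (simp add: cross_def algebra_simps)
qed

text \<open>The function \<open>cross u (z - a)\<close> is affine in \<open>z\<close> and has the
  same strict sign at both ends of the segment.\<close>

lemma cross_segment_convex:
  assumes "z \<in> closed_segment c d" and "cross u (c - a) * cross u (d - a) > 0"
  shows "cross u (z - a) \<noteq> 0"
proof -
  obtain t where t: "0 \<le> t" "t \<le> 1" and z: "z = (1 - t) *\<^sub>R c + t *\<^sub>R d"
    using assms(1) by (auto simp: in_segment)
  have eq: "cross u (z - a) = (1 - t) * cross u (c - a) + t * cross u (d - a)"
    unfolding z by (simp add: cross_def algebra_simps)
  consider "cross u (c - a) > 0" "cross u (d - a) > 0" | "cross u (c - a) < 0" "cross u (d - a) < 0"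
    using assms(2) by (auto simp: zero_less_mult_iff)
  then show ?thesis
  proof cases
    case 1
    then have "(1 - t) * cross u (c - a) + t * cross u (d - a) > 0"
      using t by (cases "t = 0") (auto intro: add_nonneg_pos)
    then show ?thesis unfolding eq by simp
  next
    case 2
    then have "(1 - t) * cross u (c - a) + t * cross u (d - a) < 0"
      using t by (intro convex_bound_lt) auto
    then show ?thesis unfolding eq by simp
  qed
qed

lemma separated_segments:
  assumes "cross (b - a) (c - a) * cross (b - a) (d - a) > 0"
  shows "closed_segment a b \<inter> closed_segment c d = {}"
  using cross_segment_convex[OF _ assms] cross_segment_zero[of _ a b] by blast

lemma adjacent_segments:
  assumes "cross (b - a) (d - a) \<noteq> 0"
  shows "closed_segment a b \<inter> closed_segment a d \<subseteq> {a}"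
proof
  fix z assume z: "z \<in> closed_segment a b \<inter> closed_segment a d"
  then obtain t where t: "z = (1 - t) *\<^sub>R a + t *\<^sub>R d"
    by (auto simp: in_segment)
  have "cross (b - a) (z - a) = t * cross (b - a) (d - a)"
    unfolding t by (simp add: cross_def algebra_simps)
  with z assms have "t = 0"
    using cross_segment_zero[of z a b] by auto
  with t show "z \<in> {a}" by simp
qed

text \<open>The difference of two common points is a multiple of both directions, hence
  zero.\<close>

lemma nonparallel_segments_meet_once:
  assumes cr: "cross (b - a) (d - c) \<noteq> 0"
    and p: "p \<in> closed_segment a b" "p \<in> closed_segment c d"
    and q: "q \<in> closed_segment a b" "q \<in> closed_segment c d"
  shows "p = q"
proof -
  obtain s s' t t' where p_eq: "p = (1 - s) *\<^sub>R a + s *\<^sub>R b" "p = (1 - t) *\<^sub>R c + t *\<^sub>R d"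
    and q_eq: "q = (1 - s') *\<^sub>R a + s' *\<^sub>R b" "q = (1 - t') *\<^sub>R c + t' *\<^sub>R d"
    using p q unfolding in_segment by blast
  have 1: "p - q = (s - s') *\<^sub>R (b - a)"
    unfolding p_eq(1) q_eq(1) by (simp add: algebra_simps)
  have 2: "p - q = (t - t') *\<^sub>R (d - c)"
    unfolding p_eq(2) q_eq(2) by (simp add: algebra_simps)
  have "0 = cross (p - q) (p - q)"
    by (simp add: cross_def)
  also have "\<dots> = cross ((s - s') *\<^sub>R (b - a)) ((t - t') *\<^sub>R (d - c))"
    unfolding 1[symmetric] 2[symmetric] ..
  also have "\<dots> = (s - s') * (t - t') * cross (b - a) (d - c)"
    by (simp add: cross_def algebra_simps)
  finally show ?thesis
    using cr 1 2 by auto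
qed

text \<open>The parameter is centred at \<open>p\<close>, as the chart in \<open>crosses_at\<close>
  must be.\<close>

lemma open_segment_parameter:
  assumes "p \<in> open_segment a b"
  obtains s where "0 < s" "s < 1"
    "\<And>x. p + x *\<^sub>R (b - a) \<in> closed_segment a b \<longleftrightarrow> - s \<le> x \<and> x \<le> 1 - s"
proof -
  obtain s where s: "0 < s" "s < 1" and p: "p = (1 - s) *\<^sub>R a + s *\<^sub>R b" and ab: "a \<noteq> b"
    using assms by (auto simp: in_segment)
  have "p + x *\<^sub>R (b - a) \<in> closed_segment a b \<longleftrightarrow> - s \<le> x \<and> x \<le> 1 - s" for x
  proof -
    have "p + x *\<^sub>R (b - a) = (1 - r) *\<^sub>R a + r *\<^sub>R b \<longleftrightarrow> r = s + x" for r
    proof -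
      have "p + x *\<^sub>R (b - a) - ((1 - r) *\<^sub>R a + r *\<^sub>R b) = (s + x - r) *\<^sub>R (b - a)"
        unfolding p by (simp add: algebra_simps)
      then have "p + x *\<^sub>R (b - a) = (1 - r) *\<^sub>R a + r *\<^sub>R b \<longleftrightarrow> (s + x - r) *\<^sub>R (b - a) = 0"
        by (metis eq_iff_diff_eq_0)
      then show ?thesis using ab by auto
    qed
    then show ?thesis by (auto simp: in_segment)
  qed
  with s show thesis by (rule that)
qed

text \<open>The chart is given by the affine coordinates at \<open>p\<close> along the two
  directions, so that \<open>U\<close> is the interior of an ellipse.\<close>

lemma crosses_at_open_segments:
  assumes cr: "cross (b - a) (d - c) \<noteq> 0" and p: "p \<in> open_segment a b" "p \<in> open_segment c d"
  shows "crosses_at (closed_segment a b) (closed_segment c d) p"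
proof -
  let ?u = "b - a" and ?v = "d - c"
  obtain s where s: "0 < s" "s < 1"
    "\<And>x. p + x *\<^sub>R ?u \<in> closed_segment a b \<longleftrightarrow> - s \<le> x \<and> x \<le> 1 - s"
    using open_segment_parameter[OF p(1)] by blast
  obtain t where t: "0 < t" "t < 1"
    "\<And>x. p + x *\<^sub>R ?v \<in> closed_segment c d \<longleftrightarrow> - t \<le> x \<and> x \<le> 1 - t"
    using open_segment_parameter[OF p(2)] by blast
  \<comment> \<open>Within parameter distance \<open>r\<close> of \<open>p\<close> neither segment
    has run past an end, so the axes of the disc are covered completely.\<close>
  define r where "r = min (min s (1 - s)) (min t (1 - t))"
  have r: "0 < r" "r \<le> s" "r \<le> 1 - s" "r \<le> t" "r \<le> 1 - t"
    using s t by (auto simp: r_def)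
  \<comment> \<open>Cramer's rule solves for the coefficients of \<open>z - p\<close> in the two
    directions, scaled by \<open>r\<close>; \<open>k\<close> is the inverse map.\<close>
  define h where "h z = Complex (cross (z - p) ?v / (r * cross ?u ?v)) (cross ?u (z - p) / (r * cross ?u ?v))" for z
  define k where "k w = p + (r * Re w) *\<^sub>R ?u + (r * Im w) *\<^sub>R ?v" for w
  have hk: "h (k w) = w" for w
  proof -
    have "cross (k w - p) ?v = Re w * (r * cross ?u ?v)" "cross ?u (k w - p) = Im w * (r * cross ?u ?v)"
      by (simp_all add: k_def cross_def algebra_simps)
    then show ?thesis
      unfolding h_def using r(1) cr by (simp add: complex_eq_iff)
  qed
  have kh: "k (h z) = z" for z
  proof -
    have "cross ?u ?v *\<^sub>R (k (h z) - p) = cross (z - p) ?v *\<^sub>R ?u + cross ?u (z - p) *\<^sub>R ?v"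
      unfolding k_def h_def using r(1) cr by (simp add: scaleR_add_right)
    also have "\<dots> = cross ?u ?v *\<^sub>R (z - p)"
      by (simp add: complex_eq_iff cross_def algebra_simps)
    finally show ?thesis using cr by simp
  qed
  have cont_h: "continuous_on A h" and cont_k: "continuous_on A k" for A
    unfolding h_def k_def cross_def
    by (intro continuous_intros; use r(1) cr in \<open>simp add: cross_def\<close>)+
  define U where "U = h -` ball 0 1"
  have "open U"
    unfolding U_def using cont_h[of UNIV] by (intro open_vimage) auto
  moreover have "h p = 0"
    by (simp add: h_def cross_def complex_eq_iff)
  moreover from this have "p \<in> U"
    by (simp add: U_def)
  moreover have "homeomorphism U (ball 0 1) h k"
    by (rule homeomorphismI) (use cont_h cont_k hk kh in \<open>auto simp: U_def\<close>)
  moreover have "h ` (closed_segment a b \<inter> U) = {z \<in> ball 0 1. Im z = 0}"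
  proof (intro equalityI subsetI)
    fix w assume "w \<in> h ` (closed_segment a b \<inter> U)"
    then obtain z where z: "z \<in> closed_segment a b" "h z \<in> ball 0 1" "w = h z"
      by (auto simp: U_def)
    have "cross ?u (z - p) = cross ?u (z - a) - cross ?u (p - a)"
      by (simp add: cross_def algebra_simps)
    also have "\<dots> = 0"
      using z(1) p(1) cross_segment_zero[of _ a b] by (simp add: open_segment_def)
    finally show "w \<in> {z \<in> ball 0 1. Im z = 0}"
      using z by (simp add: h_def)
  next
    fix w assume w: "w \<in> {z \<in> ball 0 1. Im z = 0}"
    then have "\<bar>Re w\<bar> < 1"
      using abs_Re_le_cmod[of w] by simp
    then have "r * \<bar>Re w\<bar> \<le> r"
      using r(1) by simp
    then have "\<bar>r * Re w\<bar> \<le> r"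
      using r(1) by (simp add: abs_mult)
    then have "- s \<le> r * Re w" "r * Re w \<le> 1 - s"
      using r by linarith+
    then have "p + (r * Re w) *\<^sub>R ?u \<in> closed_segment a b"
      using s(3) by blast
    then have "k w \<in> closed_segment a b"
      using w by (simp add: k_def)
    then show "w \<in> h ` (closed_segment a b \<inter> U)"
      using w hk[of w] by (intro image_eqI[of _ _ "k w"]) (auto simp: U_def)
  qed
  moreover have "h ` (closed_segment c d \<inter> U) = {z \<in> ball 0 1. Re z = 0}"
  proof (intro equalityI subsetI)
    fix w assume "w \<in> h ` (closed_segment c d \<inter> U)"
    then obtain z where z: "z \<in> closed_segment c d" "h z \<in> ball 0 1" "w = h z"
      by (auto simp: U_def)
    have "cross (z - p) ?v = cross ?v (p - c) - cross ?v (z - c)"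
      by (simp add: cross_def algebra_simps)
    also have "\<dots> = 0"
      using z(1) p(2) cross_segment_zero[of _ c d] by (simp add: open_segment_def)
    finally show "w \<in> {z \<in> ball 0 1. Re z = 0}"
      using z by (simp add: h_def)
  next
    fix w assume w: "w \<in> {z \<in> ball 0 1. Re z = 0}"
    then have "\<bar>Im w\<bar> < 1"
      using abs_Im_le_cmod[of w] by simp
    then have "r * \<bar>Im w\<bar> \<le> r"
      using r(1) by simp
    then have "\<bar>r * Im w\<bar> \<le> r"
      using r(1) by (simp add: abs_mult)
    then have "- t \<le> r * Im w" "r * Im w \<le> 1 - t"
      using r by linarith+
    then have "p + (r * Im w) *\<^sub>R ?v \<in> closed_segment c d"
      using t(3) by blast
    then have "k w \<in> closed_segment c d"
      using w by (simp add: k_def)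
    then show "w \<in> h ` (closed_segment c d \<inter> U)"
      using w hk[of w] by (intro image_eqI[of _ _ "k w"]) (auto simp: U_def)
  qed
  ultimately show ?thesis
    unfolding crosses_at_def by blast
qed

section \<open>A drawing with six crossings\<close>

text \<open>Entry \<open>v\<close> is the position of vertex number \<open>v\<close>. Integer
  coordinates make all orientation tests exact and computable.\<close>

definition grid :: "(int \<times> int) list" where
  "grid = [(3,14), (2,18), (13,17), (2,19), (20,18), (15,9), (5,7), (12,7), (9,8), (6,13),
     (2,0), (16,15), (7,16), (1,3), (20,3), (10,16), (6,11), (14,0), (15,12), (7,11)]"

text \<open>The integer version of \<open>cross\<close>, as recorded in
  \<open>cross_point\<close>.\<close>

definition orientation :: "nat \<Rightarrow> nat \<Rightarrow> nat \<Rightarrow> int" where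
  "orientation a b c =
     (fst (grid ! b) - fst (grid ! a)) * (snd (grid ! c) - snd (grid ! a)) -
     (snd (grid ! b) - snd (grid ! a)) * (fst (grid ! c) - fst (grid ! a))"

definition point :: "nat \<Rightarrow> complex" where
  "point v = Complex (of_int (fst (grid ! v))) (of_int (snd (grid ! v)))"

definition crossing_edges :: "(edge \<times> edge) list" where
  "crossing_edges = [((5,6), (7,8)), ((1,11), (2,12)), ((5,15), (8,18)), ((4,5), (11,14)),
     ((0,10), (13,16)), ((8,9), (19,12))]"

text \<open>A witness of disjointness: the line through the first edge leaves both ends of the
  second strictly on one side.\<close>

fun separates :: "edge \<Rightarrow> edge \<Rightarrow> bool" where
  "separates (a, b) (c, d) \<longleftrightarrow> orientation a b c * orientation a b d > 0"

text \<open>The difference of the two orientations is the determinant of the directions of the two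
  edges.\<close>

fun nonparallel :: "edge \<times> edge \<Rightarrow> bool" where
  "nonparallel ((a, b), (c, d)) \<longleftrightarrow> orientation a b d \<noteq> orientation a b c"

lemma cross_point: "cross (point b - point a) (point c - point a) = of_int (orientation a b c)"
  by (simp add: cross_def point_def orientation_def)

text \<open>General position: it keeps segments away from foreign vertices and prevents two edges
  with a common end from being collinear.\<close>

lemma orientation_check:
  "list_all (\<lambda>(a, b). list_all (\<lambda>v. v = a \<or> v = b \<or> orientation a b v \<noteq> 0) [0..<20]) edge_list"
  by code_simp

lemma separation_check:
  "list_all (\<lambda>e. list_all (\<lambda>f. e = f \<or> \<not> independent_edges (e, f) \<or> separates e f \<or> separates f e \<or>
     (e, f) \<in> set crossing_edges \<or> (f, e) \<in> set crossing_edges) edge_list) edge_list"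
  by code_simp

lemma nonparallel_check: "list_all nonparallel crossing_edges"
  by code_simp

section \<open>The straight-line drawing and its crossings\<close>

definition place :: "gp_vertex \<Rightarrow> complex" where
  "place v = (case v of X i \<Rightarrow> point i | Y i \<Rightarrow> point (i + 10))"

definition segment :: "edge \<Rightarrow> complex set" where
  "segment e = closed_segment (point (fst e)) (point (snd e))"

text \<open>Curves are indexed by unordered edges, so the listed direction is recovered by inverting
  \<open>edge_set\<close>.\<close>

definition straight :: "gp_vertex set \<Rightarrow> real \<Rightarrow> complex" where
  "straight Q = (let e = the_inv_into (set edge_list) edge_set Q in linepath (point (fst e)) (point (snd e)))"

lemma place_vertex: "place (vertex v) = point v"
  by (simp add: place_def vertex_def)

lemma straight_edge_set:
  "e \<in> set edge_list \<Longrightarrow> straight (edge_set e) = linepath (point (fst e)) (point (snd e))"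
  by (simp add: straight_def the_inv_into_f_f[OF inj_on_edge_set])

lemma path_image_straight: "e \<in> set edge_list \<Longrightarrow> path_image (straight (edge_set e)) = segment e"
  by (simp add: straight_edge_set segment_def)

lemma curve_interior_straight:
  "e \<in> set edge_list \<Longrightarrow> curve_interior (straight (edge_set e)) = open_segment (point (fst e)) (point (snd e))"
  by (simp add: straight_edge_set curve_interior_def open_segment_def)

lemma point_eq_iff:
  assumes "u < 20" "v < 20"
  shows "point u = point v \<longleftrightarrow> u = v"
proof -
  have "distinct grid" "length grid = 20"
    by (simp_all add: grid_def)
  moreover have "point u = point v \<longleftrightarrow> grid ! u = grid ! v"
    by (simp add: point_def prod_eq_iff)
  ultimately show ?thesis
    using assms by (simp add: nth_eq_iff_index_eq)
qed

lemma orientation_nonzero: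
  assumes "(a, b) \<in> set edge_list" "v < 20" "v \<noteq> a" "v \<noteq> b"
  shows "orientation a b v \<noteq> 0" "orientation b a v \<noteq> 0"
proof -
  show "orientation a b v \<noteq> 0"
    using orientation_check assms unfolding list_all_iff by fastforce
  moreover have "orientation b a v = - orientation a b v"
    by (simp add: orientation_def algebra_simps)
  ultimately show "orientation b a v \<noteq> 0" by simp
qed

lemma point_in_segment:
  assumes e: "e \<in> set edge_list" and v: "v < 20" and p: "point v \<in> segment e"
  shows "v = fst e \<or> v = snd e"
proof (rule ccontr)
  assume "\<not> ?thesis"
  then have "orientation (fst e) (snd e) v \<noteq> 0"
    using orientation_nonzero(1)[of "fst e" "snd e" v] e v by simp
  then show False
    using cross_segment_zero[OF p[unfolded segment_def]] by (simp add: cross_point)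
qed

lemma segments_at_common_vertex:
  assumes "orientation s t u \<noteq> 0"
    and "p \<in> closed_segment (point s) (point t)" "p \<in> closed_segment (point s) (point u)"
  shows "p = point s"
  using adjacent_segments[of "point t" "point s" "point u"] assms by (auto simp: cross_point)

text \<open>Adjacent segments meet only in the common end, which is not an interior point;
  independent segments outside the list are disjoint by \<open>separation_check\<close>.\<close>

lemma crossing_edges_complete:
  assumes e: "e \<in> set edge_list" and f: "f \<in> set edge_list" and "e \<noteq> f"
    and p: "p \<in> open_segment (point (fst e)) (point (snd e))" "p \<in> open_segment (point (fst f)) (point (snd f))"
  shows "(e, f) \<in> set crossing_edges \<or> (f, e) \<in> set crossing_edges"
proof -
  obtain a b c d where ef: "e = (a, b)" "f = (c, d)" by fastforce
  have in_ab: "p \<in> closed_segment (point a) (point b)" "p \<in> closed_segment (point b) (point a)"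
    "p \<noteq> point a" "p \<noteq> point b"
    using p(1) by (auto simp: ef open_segment_def closed_segment_commute)
  have in_cd: "p \<in> closed_segment (point c) (point d)" "p \<in> closed_segment (point d) (point c)"
    using p(2) by (auto simp: ef open_segment_def closed_segment_commute)
  note proper = edge_list_proper[OF e[unfolded ef]] edge_list_proper[OF f[unfolded ef]]
  note nz = orientation_nonzero[OF e[unfolded ef]]
  have "independent_edges (e, f)"
  proof (rule ccontr)
    assume "\<not> independent_edges (e, f)"
    then consider "a = c" | "a = d" | "b = c" | "b = d"
      unfolding ef by auto
    then show False
    proof cases
      case 1
      with \<open>e \<noteq> f\<close> proper have "orientation a b d \<noteq> 0"
        unfolding ef by (intro nz) auto
      then show False
        using segments_at_common_vertex[of a b d p] 1 in_ab in_cd by simp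
    next
      case 2
      \<comment> \<open>Here \<open>c\<close> differs from \<open>b\<close> because otherwise
        \<open>f\<close> would be the reverse of \<open>e\<close>, which is not listed.\<close>
      with e f proper have "orientation a b c \<noteq> 0"
        unfolding ef by (intro nz) auto
      then show False
        using segments_at_common_vertex[of a b c p] 2 in_ab in_cd by simp
    next
      case 3
      with e f proper have "orientation b a d \<noteq> 0"
        unfolding ef by (intro nz) auto
      then show False
        using segments_at_common_vertex[of b a d p] 3 in_ab in_cd by simp
    next
      case 4
      with \<open>e \<noteq> f\<close> proper have "orientation b a c \<noteq> 0"
        unfolding ef by (intro nz) auto
      then show False
        using segments_at_common_vertex[of b a c p] 4 in_ab in_cd by simp
    qed
  qed
  moreover have "\<not> separates e f"
    using separated_segments[of "point b" "point a" "point c" "point d"] in_ab in_cd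
    unfolding ef separates.simps cross_point of_int_mult[symmetric] of_int_0_less_iff by blast
  moreover have "\<not> separates f e"
    using separated_segments[of "point d" "point c" "point a" "point b"] in_ab in_cd
    unfolding ef separates.simps cross_point of_int_mult[symmetric] of_int_0_less_iff by blast
  ultimately show ?thesis
    using separation_check e f \<open>e \<noteq> f\<close> unfolding list_all_iff by blast
qed

lemma nonparallel_crossing_edges:
  assumes "(e, f) \<in> set crossing_edges \<or> (f, e) \<in> set crossing_edges"
  shows "cross (point (snd e) - point (fst e)) (point (snd f) - point (fst f)) \<noteq> 0"
proof -
  have eq: "cross (point b - point a) (point d - point c) = of_int (orientation a b d - orientation a b c)" for a b c d
    by (simp add: cross_def point_def orientation_def algebra_simps)
  have "cross (point b - point a) (point d - point c) \<noteq> 0" if "((a, b), (c, d)) \<in> set crossing_edges" for a b c d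
    unfolding eq using nonparallel_check that unfolding list_all_iff
    by (auto simp: of_int_eq_iff[symmetric] simp del: of_int_eq_iff)
  moreover have "cross u v = - cross v u" for u v
    by (simp add: cross_def)
  ultimately show ?thesis
    using assms by (metis neg_equal_0_iff_equal prod.collapse)
qed

text \<open>No edge occurs in two of the six pairs; this rules out three edges crossing at one
  point.\<close>

lemma crossing_edges_matching:
  assumes "(e, f) \<in> set crossing_edges \<or> (f, e) \<in> set crossing_edges"
    and "(e, g) \<in> set crossing_edges \<or> (g, e) \<in> set crossing_edges"
  shows "f = g"
  using assms by (auto simp: crossing_edges_def)

definition meeting_point :: "edge \<Rightarrow> edge \<Rightarrow> complex" where
  "meeting_point e f = (THE p. p \<in> segment e \<inter> segment f)"

lemma meeting_point_eq:
  assumes "(e, f) \<in> set crossing_edges" "p \<in> segment e" "p \<in> segment f"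
  shows "meeting_point e f = p"
  unfolding meeting_point_def
proof (rule the_equality)
  show "q = p" if "q \<in> segment e \<inter> segment f" for q
    using nonparallel_segments_meet_once[OF nonparallel_crossing_edges, of e f q p] assms that
    by (auto simp: segment_def)
qed (use assms in auto)

text \<open>A listed pair is not parallel and meets at most once, so its crossing is determined by
  the pair. Inclusion is enough for the upper bound.\<close>

lemma straight_crossings:
  "crossings (gp_edges 10 3) straight \<subseteq>
     (\<lambda>(e, f). ({edge_set e, edge_set f}, meeting_point e f)) ` set crossing_edges"
proof
  fix c assume "c \<in> crossings (gp_edges 10 3) straight"
  then obtain e f p where e: "e \<in> set edge_list" and f: "f \<in> set edge_list"
    and c: "c = ({edge_set e, edge_set f}, p)" and ne: "edge_set e \<noteq> edge_set f"
    and p: "p \<in> curve_interior (straight (edge_set e)) \<inter> curve_interior (straight (edge_set f))"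
    unfolding crossings_def gp_edges_10_3 by blast
  have "p \<in> open_segment (point (fst e)) (point (snd e))" "p \<in> open_segment (point (fst f)) (point (snd f))"
    using p by (simp_all add: curve_interior_straight e f)
  moreover from this have "p \<in> segment e" "p \<in> segment f"
    by (simp_all add: segment_def open_segment_def)
  moreover have "e \<noteq> f"
    using ne by blast
  ultimately consider "(e, f) \<in> set crossing_edges" "meeting_point e f = p"
    | "(f, e) \<in> set crossing_edges" "meeting_point f e = p"
    using crossing_edges_complete[OF e f] meeting_point_eq by blast
  then show "c \<in> (\<lambda>(e, f). ({edge_set e, edge_set f}, meeting_point e f)) ` set crossing_edges"
    by cases (auto simp: c insert_commute intro: rev_image_eqI)
qed

lemma card_straight_crossings: "card (crossings (gp_edges 10 3) straight) \<le> 6"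
proof -
  have "card (crossings (gp_edges 10 3) straight) \<le> card (set crossing_edges)"
    by (rule surj_card_le[OF _ straight_crossings]) simp
  also have "\<dots> \<le> length crossing_edges"
    by (rule card_length)
  finally show ?thesis
    by (simp add: crossing_edges_def)
qed

lemma straight_drawing: "is_drawing (gp_vertices 10) (gp_edges 10 3) place straight"
  unfolding is_drawing_def
proof (intro conjI ballI impI)
  show "inj_on place (gp_vertices 10)"
    unfolding gp_vertices_10 by (intro inj_onI) (auto simp: place_vertex point_eq_iff)
  show "finite (crossings (gp_edges 10 3) straight)"
    by (rule finite_subset[OF straight_crossings]) simp
next
  fix Q assume "Q \<in> gp_edges 10 3"
  then obtain e where e: "e \<in> set edge_list" and Q: "Q = edge_set e"
    unfolding gp_edges_10_3 by blast
  have less: "fst e < 20" "snd e < 20" "fst e \<noteq> snd e"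
    using edge_list_proper[of "fst e" "snd e"] e by auto
  show "arc (straight Q)"
    unfolding Q straight_edge_set[OF e] using less by (intro arc_linepath) (simp add: point_eq_iff)
  show "{pathstart (straight Q), pathfinish (straight Q)} = place ` Q"
    unfolding Q straight_edge_set[OF e] by (simp add: edge_set_def place_vertex)
  show "path_image (straight Q) \<inter> place ` gp_vertices 10 = place ` Q"
  proof -
    have "place ` gp_vertices 10 = point ` {..<20}"
      by (simp add: gp_vertices_10 image_image place_vertex)
    moreover have "segment e \<inter> point ` {..<20} \<subseteq> {point (fst e), point (snd e)}"
      using point_in_segment[OF e] by blast
    ultimately show ?thesis
      unfolding Q path_image_straight[OF e] using less
      by (auto simp: edge_set_def place_vertex segment_def)
  qed
next
  fix Q R p assume "Q \<in> gp_edges 10 3" "R \<in> gp_edges 10 3" and ne: "Q \<noteq> R"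
    and p: "p \<in> curve_interior (straight Q) \<inter> curve_interior (straight R)"
  then obtain e f where e: "e \<in> set edge_list" "Q = edge_set e" and f: "f \<in> set edge_list" "R = edge_set f"
    unfolding gp_edges_10_3 by blast
  have p: "p \<in> open_segment (point (fst e)) (point (snd e))" "p \<in> open_segment (point (fst f)) (point (snd f))"
    using p by (simp_all add: curve_interior_straight e f)
  have "(e, f) \<in> set crossing_edges \<or> (f, e) \<in> set crossing_edges"
    using ne e f by (intro crossing_edges_complete[OF _ _ _ p]) auto
  then show "crosses_at (path_image (straight Q)) (path_image (straight R)) p"
    unfolding e(2) f(2) path_image_straight[OF e(1)] path_image_straight[OF f(1)] segment_def
    by (intro crosses_at_open_segments p nonparallel_crossing_edges)
next
  fix Q R S assume "Q \<in> gp_edges 10 3" "R \<in> gp_edges 10 3" "S \<in> gp_edges 10 3"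
    and ne: "Q \<noteq> R \<and> Q \<noteq> S \<and> R \<noteq> S"
  then obtain e f g where e: "e \<in> set edge_list" "Q = edge_set e" and f: "f \<in> set edge_list" "R = edge_set f"
    and g: "g \<in> set edge_list" "S = edge_set g"
    unfolding gp_edges_10_3 by blast
  show "curve_interior (straight Q) \<inter> curve_interior (straight R) \<inter> curve_interior (straight S) = {}"
  proof (rule ccontr)
    assume "\<not> ?thesis"
    then obtain p where "p \<in> open_segment (point (fst e)) (point (snd e))"
      "p \<in> open_segment (point (fst f)) (point (snd f))" "p \<in> open_segment (point (fst g)) (point (snd g))"
      by (auto simp: curve_interior_straight e f g)
    then have "f = g"
      using crossing_edges_complete[OF e(1) f(1)] crossing_edges_complete[OF e(1) g(1)] ne e f g
      by (intro crossing_edges_matching[of e f g]) auto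
    with ne f g show False by simp
  qed
qed

theorem theorem1: "crossing_number (gp_vertices 10) (gp_edges 10 3) = 6"
  unfolding crossing_number_def
proof (rule Least_equality)
  \<comment> \<open>The drawing is only known to have at most six crossings; the lower bound applied
    to this same drawing gives equality.\<close>
  have "card (crossings (gp_edges 10 3) straight) = 6"
    using card_straight_crossings crossing_number_lower[OF straight_drawing] by simp
  then show "\<exists>pos \<gamma>. is_drawing (gp_vertices 10) (gp_edges 10 3) pos \<gamma> \<and> card (crossings (gp_edges 10 3) \<gamma>) = 6"
    using straight_drawing by blast
  show "6 \<le> c" if "\<exists>pos \<gamma>. is_drawing (gp_vertices 10) (gp_edges 10 3) pos \<gamma> \<and>
      card (crossings (gp_edges 10 3) \<gamma>) = c" for c
    using that crossing_number_lower by blast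
qed

end
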